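(* Let $0<q<1$ and $\kappa\in\mathbf i\mathbb R_{>0}$. For all $n,x\in\frac12\mathbb Z$ with $n\ge0$, $$\mathfrak a(x)\,\mathcal F_n(x-\tfrac12)+\mathfrak a(x+\tfrac12)\,\mathcal F_n(x+\tfrac12)=-q^n\,\mathcal F_n(x),$$ where $$\mathfrak a(x)=\left[\frac{-\kappa^2q^{2x-1}}{(1-\kappa^2q^{2x})(1-\kappa^2q^{2x-1})}\right]^{1/2},\qquad x\in\tfrac12\mathbb Z.$$
   Context: $$\mathcal F_n(x)=\sqrt{1-\kappa^{-2}q^{-2x}}\sum_{i=-n}^{n}\frac{(-1)^{n+i}q^{-i/2}}{(q;q)_{n-i}(q;q)_{n+i}}\,\frac1{\theta_{\sqrt q}\bigl(|\kappa|q^{x+i+\frac12}\bigr)},\qquad n\in\tfrac12\mathbb Z_{\ge0},\ x\in\tfrac12\mathbb Z,$$ where $\theta_p(z)=(z;p)_\infty(p/z;p)_\infty$, $(a;p)_k=\prod_{j=0}^{k-1}(1-ap^j)$, and $\frac12\mathbb Z$ is the set of all integers and half-integers. The sum runs only over those $i\in\frac12\mathbb Z$ with $-n\le i\le n$ and $n-i\in\mathbb Z$. Square roots are of positive numbers since $-\kappa^2>0$. *)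

theory Defs
  imports "HOL-Analysis.Analysis"
begin

definition half_Ints :: "real set" where
  "half_Ints = {x. 2 * x \<in> \<int>}"

definition qpoch :: "real \<Rightarrow> real \<Rightarrow> nat \<Rightarrow> real" where
  "qpoch a p k = (\<Prod>j<k. 1 - a * p ^ j)"

definition qpoch_inf :: "real \<Rightarrow> real \<Rightarrow> real" where
  "qpoch_inf a p = (\<Prod>j. 1 - a * p ^ j)"

definition theta :: "real \<Rightarrow> real \<Rightarrow> real" where
  "theta p z = qpoch_inf z p * qpoch_inf (p / z) p"

(* In sum_range n with n in half_Ints, both n - i and n + i are nonnegative
   integers, so the floors in F_fun below are exact. *)
definition sum_range :: "real \<Rightarrow> real set" where
  "sum_range n = {i \<in> half_Ints. - n \<le> i \<and> i \<le> n \<and> n - i \<in> \<int>}"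

(* The parameter \<kappa> is purely imaginary, so the arguments of csqrt below are positive
   reals and the principal root is the usual positive square root. If \<bar>\<kappa>\<bar> is an integer
   power of sqrt q, all the theta values in F_fun vanish; the quotients are then 0 by the
   convention 1 / 0 = 0. *)
definition F_fun :: "real \<Rightarrow> complex \<Rightarrow> real \<Rightarrow> real \<Rightarrow> complex" where
  "F_fun q \<kappa> n x =
     csqrt (1 - \<kappa> powi (-2) * of_real (q powr (- 2 * x))) *
     of_real (\<Sum>i\<in>sum_range n.
       ((-1) ^ nat \<lfloor>n + i\<rfloor> * q powr (- i / 2))
         / (qpoch q q (nat \<lfloor>n - i\<rfloor>) * qpoch q q (nat \<lfloor>n + i\<rfloor>))
       * (1 / theta (sqrt q) (cmod \<kappa> * q powr (x + i + 1/2))))"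

definition a_fun :: "real \<Rightarrow> complex \<Rightarrow> real \<Rightarrow> complex" where
  "a_fun q \<kappa> x =
     csqrt (- (\<kappa>\<^sup>2) * of_real (q powr (2 * x - 1))
       / ((1 - \<kappa>\<^sup>2 * of_real (q powr (2 * x))) * (1 - \<kappa>\<^sup>2 * of_real (q powr (2 * x - 1)))))"

end

theory Submission
  imports Defs
begin

text \<open>Put \<open>u = \<bar>\<kappa>\<bar> q\<^sup>x\<close>. The square roots combine so that the claim becomes the relation
  \<open>S(x - 1/2) + q\<^bsup>-1/2\<^esup> S(x + 1/2) = - q\<^sup>n (u + 1/u) S(x)\<close> for the sum \<open>S\<close> in \<open>\<F>\<^sub>n\<close>.
  By the quasi-periodicity \<open>\<theta>\<^sub>p(p z) = - \<theta>\<^sub>p(z) / z\<close> with \<open>p = \<surd>q\<close>,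
  the \<open>i\<close>-th summands of the three sums are multiples of \<open>r\<^sub>i = c\<^sub>i / \<theta>\<^sub>p(u q\<^sup>i)\<close>, and the difference of the two sides is
  \<open>\<Sum>\<^sub>i r\<^sub>i ((1 - q\<^bsup>n+i\<^esup>) + u\<^sup>2 q\<^bsup>2i\<^esup> (1 - q\<^bsup>n-i\<^esup>))\<close>. This sum telescopes, since
  \<open>r\<^bsub>i+1\<^esub> (1 - q\<^bsup>n+i+1\<^esup>) = - r\<^sub>i u\<^sup>2 q\<^bsup>2i\<^esup> (1 - q\<^bsup>n-i\<^esup>)\<close>.\<close>

text \<open>The geometric series gives absolute convergence; \<open>convergent_prod\<close>
  tolerates finitely many zero factors, so zeros of the product are covered.\<close>

lemma qpoch_inf_LIMSEQ:
  assumes "\<bar>p\<bar> < 1"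
  shows "(\<lambda>n. \<Prod>j<n. 1 - a * p ^ j) \<longlonglongrightarrow> qpoch_inf a p"
proof -
  have "summable (\<lambda>j. norm (1 - a * p ^ j - 1))"
    using assms by (simp add: abs_mult power_abs summable_mult summable_geometric)
  then have "convergent_prod (\<lambda>j. 1 - a * p ^ j)"
    by (intro abs_convergent_prod_imp_convergent_prod summable_imp_abs_convergent_prod)
  from convergent_prod_LIMSEQ[OF this]
  have "(\<lambda>n. \<Prod>j<Suc n. 1 - a * p ^ j) \<longlonglongrightarrow> qpoch_inf a p"
    by (simp add: qpoch_inf_def lessThan_Suc_atMost)
  then show ?thesis by (rule LIMSEQ_imp_Suc)
qed

lemma qpoch_inf_rec:
  assumes "\<bar>p\<bar> < 1"
  shows "qpoch_inf a p = (1 - a) * qpoch_inf (a * p) p"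
proof -
  have "(\<lambda>n. (1 - a) * (\<Prod>j<n. 1 - (a * p) * p ^ j)) \<longlonglongrightarrow> (1 - a) * qpoch_inf (a * p) p"
    by (intro tendsto_intros qpoch_inf_LIMSEQ assms)
  moreover have "(1 - a) * (\<Prod>j<n. 1 - (a * p) * p ^ j) = (\<Prod>j<Suc n. 1 - a * p ^ j)" for n
    by (simp add: prod.lessThan_Suc_shift mult.assoc del: prod.lessThan_Suc)
  moreover have "(\<lambda>n. \<Prod>j<Suc n. 1 - a * p ^ j) \<longlonglongrightarrow> qpoch_inf a p"
    using qpoch_inf_LIMSEQ[OF assms] by (rule LIMSEQ_Suc)
  ultimately show ?thesis using LIMSEQ_unique by simp
qed

text \<open>Both theta values contain \<open>qpoch_inf (p * z) p * qpoch_inf (p / z) p\<close>. The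
  factors left over are \<open>1 - 1 / z\<close> and \<open>1 - z\<close>, with quotient
  \<open>- 1 / z\<close>.\<close>

lemma theta_shift:
  assumes "0 < p" "p < 1" "z \<noteq> 0"
  shows "theta p (p * z) = - theta p z / z"
proof -
  have "qpoch_inf z p = (1 - z) * qpoch_inf (p * z) p"
    using qpoch_inf_rec[of p z] assms by (simp add: mult.commute)
  moreover have "qpoch_inf (1 / z) p = (1 - 1 / z) * qpoch_inf (p / z) p"
    using qpoch_inf_rec[of p "1 / z"] assms by simp
  moreover have "theta p (p * z) = qpoch_inf (p * z) p * qpoch_inf (1 / z) p"
    using assms by (simp add: theta_def)
  ultimately have "theta p (p * z) = (1 - 1 / z) * (qpoch_inf (p * z) p * qpoch_inf (p / z) p)"
    and "theta p z = (1 - z) * (qpoch_inf (p * z) p * qpoch_inf (p / z) p)"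
    by (simp_all add: theta_def)
  moreover have "1 - 1 / z = - ((1 - z) / z)" using assms by (simp add: field_simps)
  ultimately show ?thesis by (metis minus_divide_left mult_minus_left times_divide_eq_left)
qed

text \<open>At a zero of theta both sides are 0 by \<open>1 / 0 = 0\<close>, so the degenerate
  values of \<kappa> need no separate case later.\<close>

lemma inverse_theta_shift:
  assumes "0 < p" "p < 1" "z \<noteq> 0"
  shows "1 / theta p (p * z) = - z / theta p z"
  using theta_shift[OF assms] by simp

lemma inverse_theta_shift2:
  assumes "0 < p" "p < 1" "z \<noteq> 0"
  shows "1 / theta p (p\<^sup>2 * z) = p * z\<^sup>2 / theta p z"
  using theta_shift[of p "p * z"] theta_shift[OF assms] assms
  by (simp add: power2_eq_square mult_ac)

lemma qpoch_Suc: "qpoch q q (Suc k) = qpoch q q k * (1 - q ^ Suc k)"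
  by (simp add: qpoch_def)

lemma qpoch_nonzero:
  assumes "0 < q" "q < 1"
  shows "qpoch q q k \<noteq> 0"
proof (induction k)
  case (Suc k)
  have "q ^ Suc k < 1" using assms power_Suc_less_one by blast
  with Suc show ?case unfolding qpoch_Suc by simp
qed (simp add: qpoch_def)

text \<open>Each \<open>B j\<close> cancels \<open>A (Suc j)\<close>, so the partial sum up to
  \<open>m\<close> is just \<open>B m\<close>.\<close>

lemma sum_telescope_opposite:
  fixes A B :: "nat \<Rightarrow> 'a::ab_group_add"
  assumes "A 0 = 0" "\<And>j. j < N \<Longrightarrow> A (Suc j) = - B j" "B N = 0"
  shows "(\<Sum>j\<le>N. A j + B j) = 0"
proof -
  have "m \<le> N \<Longrightarrow> (\<Sum>j\<le>m. A j + B j) = B m" for m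
    by (induction m) (simp_all add: assms)
  then show ?thesis using assms(3) by simp
qed

text \<open>The sum in \<open>F_fun\<close> without its square root, reindexed over the naturals by
  \<open>N = 2 n\<close>, \<open>j = n + i\<close>; \<open>k\<close> stands for the modulus of
  \<kappa>.\<close>

definition theta_sum :: "real \<Rightarrow> real \<Rightarrow> nat \<Rightarrow> real \<Rightarrow> real" where
  "theta_sum q k N x = (\<Sum>j\<le>N. (-1) ^ j * q powr ((real N / 2 - real j) / 2)
     / (qpoch q q (N - j) * qpoch q q j)
     * (1 / theta (sqrt q) (k * q powr (x + (real j - real N / 2) + 1/2))))"

lemma sum_range_half_nat:
  "sum_range (real N / 2) = (\<lambda>j. real j - real N / 2) ` {..N}"
proof (intro equalityI subsetI)
  fix i assume i: "i \<in> sum_range (real N / 2)"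
  then obtain m where m: "real N / 2 - i = of_int m"
    by (auto simp: sum_range_def elim: Ints_cases)
  have "0 \<le> m" "m \<le> int N" using i m by (auto simp: sum_range_def)
  then have "i = real (nat (int N - m)) - real N / 2" "nat (int N - m) \<le> N"
    using m by auto
  then show "i \<in> (\<lambda>j. real j - real N / 2) ` {..N}" by blast
next
  fix i assume "i \<in> (\<lambda>j. real j - real N / 2) ` {..N}"
  then obtain j where j: "j \<le> N" "i = real j - real N / 2" by auto
  have "2 * i = of_int (2 * int j - int N)" "real N / 2 - i = of_int (int N - int j)"
    using j by simp_all
  then have "2 * i \<in> \<int>" "real N / 2 - i \<in> \<int>" by (metis Ints_of_int)+
  then show "i \<in> sum_range (real N / 2)" using j by (auto simp: sum_range_def half_Ints_def)
qed

lemma F_fun_eq_theta_sum: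
  "F_fun q \<kappa> (real N / 2) x =
     csqrt (1 - \<kappa> powi (-2) * of_real (q powr (- 2 * x))) * of_real (theta_sum q (cmod \<kappa>) N x)"
proof -
  have inj: "inj_on (\<lambda>j. real j - real N / 2) {..N}" by (auto simp: inj_on_def)
  have fl: "nat \<lfloor>real N - real j\<rfloor> = N - j" for j
    by (metis floor_of_int of_int_diff of_int_of_nat_eq nat_minus_as_int)
  have ex: "- ((real j - real N / 2) / 2) = (real N / 2 - real j) / 2" for j by (simp add: field_simps)
  show ?thesis
    unfolding F_fun_def theta_sum_def sum_range_half_nat sum.reindex[OF inj]
    by (intro arg_cong2[of _ _ _ _ "(*)"] refl arg_cong[of _ _ of_real] sum.cong)
       (simp_all add: fl ex)
qed

lemma theta_sum_rec:
  fixes q k x :: real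
  assumes q: "0 < q" "q < 1" and k: "0 < k"
  defines "u \<equiv> k * q powr x"
  shows "theta_sum q k N (x - 1/2) + theta_sum q k N (x + 1/2) / sqrt q
         = - (q powr (real N / 2)) * ((1 + u\<^sup>2) / u) * theta_sum q k N x"
proof -
  define p where "p = sqrt q"
  have p: "0 < p" "p < 1" "p\<^sup>2 = q" using q by (auto simp: p_def)
  have q12: "q powr (1/2) = p" using q by (simp add: p_def powr_half_sqrt)
  define n where "n = real N / 2"
  define c where "c j = (-1) ^ j * q powr ((n - real j) / 2) / (qpoch q q (N - j) * qpoch q q j)"
    for j
  \<comment> \<open>This is the theta argument at \<open>x - 1/2\<close>. Each half step in
    \<open>x\<close> multiplies it by \<open>p\<close>, giving \<open>p * z j\<close> at
    \<open>x\<close> and \<open>p\<^sup>2 * z j\<close> at \<open>x + 1/2\<close>.\<close>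
  define z where "z j = k * q powr (x + (real j - n))" for j
  define r where "r j = c j / theta p (z j)" for j
  have u: "u > 0" using q k by (simp add: u_def)
  have z: "z j > 0" for j using q k by (simp add: z_def)
  have zu: "z j = u * q powr (real j - n)" for j
    by (simp add: z_def u_def powr_add)
  have shift0: "theta_sum q k N (x - 1/2) = (\<Sum>j\<le>N. r j)"
    by (simp add: theta_sum_def r_def c_def z_def n_def p_def)
  have "k * q powr (x + (real j - n) + 1/2) = p * z j" for j
    unfolding z_def powr_add[of q _ "1/2"] q12 by simp
  then have "theta_sum q k N x = (\<Sum>j\<le>N. c j * (1 / theta p (p * z j)))"
    by (simp add: theta_sum_def c_def n_def p_def)
  then have shift1: "theta_sum q k N x = (\<Sum>j\<le>N. - z j * r j)"
    using inverse_theta_shift[OF p(1,2)] z by (simp add: r_def less_imp_neq[symmetric] mult.commute)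
  have "k * q powr (x + 1/2 + (real j - n) + 1/2) = p\<^sup>2 * z j" for j
  proof -
    have "k * q powr (x + 1/2 + (real j - n) + 1/2) = k * q powr ((x + (real j - n)) + 1)"
      by (simp add: algebra_simps)
    then show ?thesis using q p(3) by (simp add: z_def powr_add)
  qed
  then have "theta_sum q k N (x + 1/2) = (\<Sum>j\<le>N. c j * (1 / theta p (p\<^sup>2 * z j)))"
    by (simp add: theta_sum_def c_def n_def p_def)
  also have "\<dots> = p * (\<Sum>j\<le>N. (z j)\<^sup>2 * r j)"
    unfolding sum_distrib_left
  proof (intro sum.cong refl)
    fix j
    show "c j * (1 / theta p (p\<^sup>2 * z j)) = p * ((z j)\<^sup>2 * r j)"
      using inverse_theta_shift2[OF p(1,2), of "z j"] z[of j] by (simp add: r_def)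
  qed
  \<comment> \<open>The weight \<open>1 / sqrt q\<close> in the claim absorbs the factor
    \<open>p\<close> from the double shift.\<close>
  finally have shift2: "theta_sum q k N (x + 1/2) / p = (\<Sum>j\<le>N. (z j)\<^sup>2 * r j)"
    using p(1) by simp
  \<comment> \<open>With \<open>i = j - n\<close> the exponents \<open>j\<close> and
    \<open>N - j\<close> are \<open>n + i\<close> and \<open>n - i\<close>. They vanish at
    \<open>j = 0\<close> and \<open>j = N\<close> respectively, which gives the boundary conditions
    of the telescoping.\<close>
  define A where "A j = r j * (1 - q ^ j)" for j
  define B where "B j = r j * ((z j)\<^sup>2 * (1 - q ^ (N - j)))" for j
  have "(\<Sum>j\<le>N. A j + B j) = 0"
  proof (rule sum_telescope_opposite)
    show "A 0 = 0" "B N = 0" by (simp_all add: A_def B_def)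
    fix j assume j: "j < N"
    have zS: "z (Suc j) = p\<^sup>2 * z j"
    proof -
      have "z (Suc j) = k * q powr ((x + (real j - n)) + 1)"
        by (simp add: z_def algebra_simps)
      also have "\<dots> = p\<^sup>2 * z j"
        unfolding powr_add[of q _ 1] z_def p(3) using q by simp
      finally show ?thesis .
    qed
    have pw: "q powr ((n - real j) / 2) = q powr ((n - real (Suc j)) / 2) * p"
      unfolding q12[symmetric] powr_add[symmetric] by (simp add: field_simps)
    have ne: "qpoch q q m \<noteq> 0" for m using qpoch_nonzero[OF q] .
    have "N - j = Suc (N - Suc j)" using j by simp
    then have P1: "qpoch q q (N - j) = qpoch q q (N - Suc j) * (1 - q ^ (N - j))"
      by (metis qpoch_Suc)
    then have ne1: "1 - q ^ (N - j) \<noteq> 0" using ne by (metis mult_zero_right)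
    have ne2: "1 - q ^ Suc j \<noteq> 0" using ne qpoch_Suc by (metis mult_zero_right)
    \<comment> \<open>The sign comes from \<open>(-1) ^ j\<close>, the \<open>p\<close> from the
      power of \<open>q\<close>, and each finite product changes by one factor. The same
      \<open>p\<close> appears in \<open>inverse_theta_shift2\<close>.\<close>
    have c: "p * c (Suc j) * (1 - q ^ Suc j) = - c j * (1 - q ^ (N - j))"
      unfolding c_def P1 qpoch_Suc[of q j] pw
      using ne1 ne2 ne[of j] ne[of "N - Suc j"] by (simp add: divide_simps)
    have "A (Suc j) = c (Suc j) * (1 / theta p (p\<^sup>2 * z j)) * (1 - q ^ Suc j)"
      by (simp add: A_def r_def zS)
    also have "\<dots> = (p * c (Suc j) * (1 - q ^ Suc j)) * ((z j)\<^sup>2 / theta p (z j))"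
      using inverse_theta_shift2[OF p(1,2), of "z j"] z[of j] by simp
    also have "\<dots> = - B j"
      unfolding c by (simp add: B_def r_def)
    finally show "A (Suc j) = - B j" .
  qed
  \<comment> \<open>With \<open>e\<close> the power of \<open>q\<close> in
    \<open>z j = u * e\<close>, the negative terms of \<open>A j\<close> and \<open>B j\<close>
    combine to \<open>- q powr n * (1 + u\<^sup>2) * e * r j\<close>.\<close>
  moreover have "A j + B j = r j + (z j)\<^sup>2 * r j + q powr n * ((1 + u\<^sup>2) / u) * (- z j * r j)"
    if "j \<le> N" for j
  proof -
    define e where "e = q powr (real j - n)"
    have e1: "q ^ j = q powr n * e"
      using q by (simp add: e_def powr_add[symmetric] powr_realpow)
    have "q ^ (N - j) = q powr (real N - real j)"
      using q that by (simp add: powr_realpow[symmetric])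
    then have "e * q ^ (N - j) = q powr n"
      by (simp add: e_def n_def powr_add[symmetric])
    then have e2: "e\<^sup>2 * (1 - q ^ (N - j)) = e\<^sup>2 - q powr n * e"
      by (simp add: power2_eq_square right_diff_distrib mult.assoc)
    have AB: "A j + B j = r j * (1 - q powr n * e + u\<^sup>2 * (e\<^sup>2 * (1 - q ^ (N - j))))"
      unfolding A_def B_def zu e_def[symmetric] e1 by (simp add: algebra_simps power_mult_distrib)
    have zr: "(1 + u\<^sup>2) / u * (- z j * r j) = - ((1 + u\<^sup>2) * (e * r j))"
      unfolding zu e_def[symmetric] using u by simp
    show ?thesis
      unfolding AB e2 mult.assoc[of "q powr n"] zr
      by (simp add: zu e_def[symmetric] algebra_simps power_mult_distrib)
  qed
  ultimately have "(\<Sum>j\<le>N. r j + (z j)\<^sup>2 * r j + q powr n * ((1 + u\<^sup>2) / u) * (- z j * r j)) = 0"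
    by simp
  then have "(\<Sum>j\<le>N. r j) + (\<Sum>j\<le>N. (z j)\<^sup>2 * r j)
      + q powr n * ((1 + u\<^sup>2) / u) * (\<Sum>j\<le>N. - z j * r j) = 0"
    by (simp only: sum.distrib sum_distrib_left)
  then show ?thesis
    unfolding n_def[symmetric] p_def[symmetric] shift0 shift1 shift2
    by (simp only: mult_minus_left eq_neg_iff_add_eq_0)
qed

theorem propositionA2:
  fixes q n x :: real and \<kappa> :: complex
  assumes "0 < q" and "q < 1"
    and "Re \<kappa> = 0" and "Im \<kappa> > 0"
    and "n \<in> half_Ints" and "n \<ge> 0" and "x \<in> half_Ints"
  shows "a_fun q \<kappa> x * F_fun q \<kappa> n (x - 1/2) + a_fun q \<kappa> (x + 1/2) * F_fun q \<kappa> n (x + 1/2)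
         = - of_real (q powr n) * F_fun q \<kappa> n x"
proof -
  define k where "k = Im \<kappa>"
  have k: "k > 0" using assms by (simp add: k_def)
  have \<kappa>: "\<kappa> = \<i> * of_real k" using assms by (simp add: complex_eq_iff k_def)
  have cm: "cmod \<kappa> = k" using k by (simp add: \<kappa> norm_mult)
  have \<kappa>2: "\<kappa>\<^sup>2 = - of_real (k\<^sup>2)" by (simp add: \<kappa> power_mult_distrib)
  obtain m where m: "2 * n = of_int m" using assms by (auto simp: half_Ints_def elim: Ints_cases)
  with assms have "m \<ge> 0" by linarith
  then have n: "n = real (nat m) / 2" using m by simp
  define N where "N = nat m"
  have nN: "real N / 2 = n" using n by (simp add: N_def)
  \<comment> \<open>Since \<open>\<kappa>\<^sup>2\<close> is \<open>- k\<^sup>2\<close>, every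
    radicand is a positive real expressible by \<open>U\<close>, and \<open>csqrt\<close> turns into
    \<open>sqrt\<close>.\<close>
  define U where "U y = k * q powr y" for y
  have U: "U y > 0" for y using k assms by (simp add: U_def)
  have U2: "(U y)\<^sup>2 = k\<^sup>2 * q powr (2 * y)" for y
    using assms by (simp add: U_def power_mult_distrib powr_power)
  have pos: "1 + (U y)\<^sup>2 > 0" for y by (simp add: add_pos_nonneg)
  have F: "F_fun q \<kappa> n y = of_real (sqrt (1 + (U y)\<^sup>2) / U y * theta_sum q k N y)" for y
  proof -
    have "1 - \<kappa> powi (-2) * of_real (q powr (- 2 * y)) = of_real ((1 + (U y)\<^sup>2) / (U y)\<^sup>2)"
      using k assms(1)
      by (simp add: power_int_minus \<kappa>2 U2 powr_minus field_simps)
    moreover have "csqrt (of_real ((1 + (U y)\<^sup>2) / (U y)\<^sup>2)) = of_real (sqrt (1 + (U y)\<^sup>2) / U y)"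
      using U[of y] pos[of y] by (subst csqrt_of_real_nonneg) (auto simp: real_sqrt_divide)
    ultimately show ?thesis
      unfolding n F_fun_eq_theta_sum cm N_def by simp
  qed
  have a: "a_fun q \<kappa> y = of_real (U (y - 1/2) / (sqrt (1 + (U y)\<^sup>2) * sqrt (1 + (U (y - 1/2))\<^sup>2)))" for y
  proof -
    have U2': "(U (y - 1/2))\<^sup>2 = k\<^sup>2 * q powr (2 * y - 1)" by (simp add: U2 algebra_simps)
    have "- (\<kappa>\<^sup>2) * of_real (q powr (2 * y - 1))
       / ((1 - \<kappa>\<^sup>2 * of_real (q powr (2 * y))) * (1 - \<kappa>\<^sup>2 * of_real (q powr (2 * y - 1))))
      = of_real ((U (y - 1/2))\<^sup>2 / ((1 + (U y)\<^sup>2) * (1 + (U (y - 1/2))\<^sup>2)))"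
      by (simp add: \<kappa>2 U2' U2[of y])
    moreover have "csqrt \<dots> = of_real (U (y - 1/2) / (sqrt (1 + (U y)\<^sup>2) * sqrt (1 + (U (y - 1/2))\<^sup>2)))"
      using U[of "y - 1/2"] pos[of y] pos[of "y - 1/2"]
      by (subst csqrt_of_real_nonneg) (auto simp: real_sqrt_divide real_sqrt_mult)
    ultimately show ?thesis unfolding a_fun_def by simp
  qed
  define s where "s = sqrt (1 + (U x)\<^sup>2)"
  have s: "s > 0" "s\<^sup>2 = 1 + (U x)\<^sup>2" using pos[of x] by (simp_all add: s_def)
  have Up: "U (x + 1/2) = U x * sqrt q"
    using assms by (simp add: U_def powr_add powr_half_sqrt)
  have 1: "a_fun q \<kappa> x * F_fun q \<kappa> n (x - 1/2) = of_real (theta_sum q k N (x - 1/2) / s)"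
    unfolding a F of_real_mult[symmetric] s_def[symmetric]
    using U[of "x - 1/2"] pos[of "x - 1/2"] s(1) by simp
  \<comment> \<open>The roots at \<open>x + 1/2\<close> cancel, and \<open>U x / U (x + 1/2)\<close>
    is the source of \<open>1 / sqrt q\<close>.\<close>
  have 2: "a_fun q \<kappa> (x + 1/2) * F_fun q \<kappa> n (x + 1/2)
      = of_real (theta_sum q k N (x + 1/2) / sqrt q / s)"
  proof -
    define t where "t = sqrt (1 + (U (x + 1/2))\<^sup>2)"
    have t: "t > 0" using pos[of "x + 1/2"] by (simp add: t_def)
    have e: "x + 1/2 - 1/2 = x" by simp
    show ?thesis
      unfolding a F of_real_mult[symmetric] e s_def[symmetric] t_def[symmetric]
      unfolding Up
      using U[of x] t s(1) assms(1) by (simp add: field_simps)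
  qed
  have "a_fun q \<kappa> x * F_fun q \<kappa> n (x - 1/2) + a_fun q \<kappa> (x + 1/2) * F_fun q \<kappa> n (x + 1/2)
      = of_real ((theta_sum q k N (x - 1/2) + theta_sum q k N (x + 1/2) / sqrt q) / s)"
    unfolding 1 2 by (simp add: add_divide_distrib)
  \<comment> \<open>The factor \<open>(1 + u\<^sup>2) / u\<close> equals
    \<open>s\<^sup>2 / U x\<close>; after division by \<open>s\<close> it is the prefactor of
    \<open>F_fun\<close> at \<open>x\<close>.\<close>
  also have "(theta_sum q k N (x - 1/2) + theta_sum q k N (x + 1/2) / sqrt q) / s
      = - (q powr n) * (s / U x * theta_sum q k N x)"
    unfolding theta_sum_rec[OF assms(1,2) k] U_def[symmetric] s(2)[symmetric] nN
    using s(1) by (simp add: power2_eq_square)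
  finally show ?thesis unfolding F s_def by simp
qed

end
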